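(* For any convex body $K\subset\mathbb{R}^n$ containing the origin and every $\lambda\in[0,1]$, \[ \mathrm{Vol}\big((1-\lambda)K\vee(-\lambda K)\big)\le \mathrm{Vol}(K). \]
   Context: A convex body is a compact convex subset of $\mathbb{R}^n$ with non-empty interior. For sets $A,B$, $A\vee B$ denotes the convex hull of $A\cup B$. *)

theory Defs
  imports "HOL-Analysis.Analysis"
begin

definition convex_body :: "'a::euclidean_space set \<Rightarrow> bool" where
  "convex_body K \<longleftrightarrow> compact K \<and> convex K \<and> interior K \<noteq> {}"

end

theory Submission
  imports Defs
begin

text \<open>
  For compact convex sets \<open>A\<close> and \<open>B\<close> containing the origin let \<open>J A B\<close> (\<open>free_join\<close> below) be the convex hull of
  \<open>A \<times> {0} \<union> {0} \<times> B\<close>. Its fibre over \<open>x \<in> A\<close> is a copy of \<open>B\<close> scaled by a factor that does not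
  depend on \<open>B\<close>, hence \<open>vol B' * vol (J A B) = vol B * vol (J A B')\<close>; with the symmetry
  \<open>vol (J A B) = vol (J B A)\<close> this gives \<open>vol D * vol (J K K) = vol K * vol (J D K)\<close>, where \<open>D\<close> is
  the convex hull in the theorem. It remains to see that \<open>vol (J D K) \<le> vol (J K K)\<close>. The map
  \<open>(u, v) \<mapsto> ((1 - l) u - l v, u + v)\<close> preserves volume, and it sends \<open>J K K\<close> to a convex set that
  projects onto \<open>D\<close> and whose fibre over the origin contains \<open>K\<close>. By convexity its fibre over \<open>x\<close>
  contains a translate of the fibre of \<open>J D K\<close> over \<open>x\<close>.
\<close>

section \<open>Free joins: convexity, compactness and fibres\<close>

text \<open>For nonempty convex \<open>A\<close> and \<open>B\<close> this is the hull named above.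
  The parametrised form turns compactness into continuity of a map and membership into a choice of
  witnesses.\<close>

definition free_join :: "'a::real_vector set \<Rightarrow> 'b::real_vector set \<Rightarrow> ('a \<times> 'b) set" where
  "free_join A B = (\<lambda>(t, a, b). (t *\<^sub>R a, (1 - t) *\<^sub>R b)) ` ({0..1} \<times> A \<times> B)"

lemma mem_free_join:
  "(x, y) \<in> free_join A B \<longleftrightarrow>
    (\<exists>t a b. 0 \<le> t \<and> t \<le> 1 \<and> a \<in> A \<and> b \<in> B \<and> x = t *\<^sub>R a \<and> y = (1 - t) *\<^sub>R b)"
  unfolding free_join_def by force

lemma free_joinI:
  assumes "0 \<le> t" "t \<le> 1" "a \<in> A" "b \<in> B" "x = t *\<^sub>R a" "y = (1 - t) *\<^sub>R b"
  shows "(x, y) \<in> free_join A B"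
  using assms mem_free_join by blast

lemma compact_free_join:
  fixes A :: "'a::real_normed_vector set" and B :: "'b::real_normed_vector set"
  assumes "compact A" "compact B"
  shows "compact (free_join A B)"
  unfolding free_join_def case_prod_unfold
  by (intro compact_continuous_image compact_Times assms compact_Icc continuous_intros)

lemma free_join_swap:
  assumes "(x, y) \<in> free_join A B"
  shows "(y, x) \<in> free_join B A"
proof -
  obtain t a b where "0 \<le> t" "t \<le> 1" "a \<in> A" "b \<in> B" "x = t *\<^sub>R a" "y = (1 - t) *\<^sub>R b"
    using assms unfolding mem_free_join by blast
  then show ?thesis
    by (intro free_joinI[of "1 - t" b B a A]) auto
qed

text \<open>Normalise the coefficients by \<open>s + t\<close>; if that sum is 0, both vanish and
  any point serves. This merges weights that do not add up to 1, as happens in each factor of a free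
  join.\<close>

lemma convex_conic_combination:
  assumes "convex A" "x \<in> A" "y \<in> A" "0 \<le> s" "0 \<le> t"
  obtains z where "z \<in> A" "s *\<^sub>R x + t *\<^sub>R y = (s + t) *\<^sub>R z"
proof (cases "s + t = 0")
  case True
  then have "s = 0" "t = 0" using assms by auto
  with that[of x] assms show ?thesis by simp
next
  case False
  let ?z = "(s / (s + t)) *\<^sub>R x + (t / (s + t)) *\<^sub>R y"
  have "?z \<in> A"
    using assms False by (intro convexD[OF \<open>convex A\<close>]) (auto simp flip: add_divide_distrib)
  moreover have "s *\<^sub>R x + t *\<^sub>R y = (s + t) *\<^sub>R ?z"
    using False by (simp add: scaleR_add_right)
  ultimately show ?thesis using that by blast
qed

text \<open>The points of \<open>A\<close> and those of \<open>B\<close> merge separately, with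
  total weights \<open>r * t + (1 - r) * s\<close> and its complement to 1.\<close>

lemma convex_free_join_combination:
  assumes A: "convex A" and B: "convex B"
    and p: "(x, y) \<in> free_join A B" "(x', y') \<in> free_join A B"
    and r: "0 \<le> r" "r \<le> 1"
  shows "(r *\<^sub>R x + (1 - r) *\<^sub>R x', r *\<^sub>R y + (1 - r) *\<^sub>R y') \<in> free_join A B"
proof -
  obtain t a b where t: "0 \<le> t" "t \<le> 1" "a \<in> A" "b \<in> B" "x = t *\<^sub>R a" "y = (1 - t) *\<^sub>R b"
    using p unfolding mem_free_join by blast
  obtain s c d where s: "0 \<le> s" "s \<le> 1" "c \<in> A" "d \<in> B" "x' = s *\<^sub>R c" "y' = (1 - s) *\<^sub>R d"
    using p unfolding mem_free_join by blast
  obtain e where e: "e \<in> A" "(r * t) *\<^sub>R a + ((1 - r) * s) *\<^sub>R c = (r * t + (1 - r) * s) *\<^sub>R e"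
    using convex_conic_combination[OF A \<open>a \<in> A\<close> \<open>c \<in> A\<close>, of "r * t" "(1 - r) * s"] t s r
    by (metis diff_ge_0_iff_ge mult_nonneg_nonneg)
  obtain f where f: "f \<in> B" "(r * (1 - t)) *\<^sub>R b + ((1 - r) * (1 - s)) *\<^sub>R d
      = (r * (1 - t) + (1 - r) * (1 - s)) *\<^sub>R f"
    using convex_conic_combination[OF B \<open>b \<in> B\<close> \<open>d \<in> B\<close>, of "r * (1 - t)" "(1 - r) * (1 - s)"] t s r
    by (metis diff_ge_0_iff_ge mult_nonneg_nonneg)
  have "r * t + (1 - r) * s \<le> r * 1 + (1 - r) * 1"
    using t s r by (intro add_mono mult_left_mono) auto
  moreover have "r * (1 - t) + (1 - r) * (1 - s) = 1 - (r * t + (1 - r) * s)"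
    by (simp add: algebra_simps)
  ultimately show ?thesis
    using t s r e f by (intro free_joinI[of "r * t + (1 - r) * s" e A f B]) auto
qed

text \<open>The factor \<open>r\<close> is the value of the gauge of \<open>A\<close> at \<open>x\<close>.\<close>

lemma free_join_fibre:
  fixes A :: "'a::real_normed_vector set"
  assumes A: "compact A" and x: "x \<in> A"
  obtains r where "0 \<le> r" "r \<le> 1" "x \<in> (*\<^sub>R) r ` A"
    "\<And>B :: 'b::real_vector set. convex B \<Longrightarrow> 0 \<in> B \<Longrightarrow> Pair x -` free_join A B = (*\<^sub>R) (1 - r) ` B"
proof -
  \<comment> \<open>\<open>P\<close> collects the representations of \<open>x\<close> as
    \<open>t *\<^sub>R a\<close>. It is compact and contains \<open>(1, x)\<close>, so a least
    \<open>t\<close> is attained; this is \<open>r\<close>.\<close>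
  define P where "P = ({0..1::real} \<times> A) \<inter> (\<lambda>(t, a). t *\<^sub>R a) -` {x}"
  have "closed P"
    unfolding P_def case_prod_unfold using A
    by (intro continuous_closed_preimage continuous_intros compact_imp_closed compact_Times) auto
  then have "compact (({0..1::real} \<times> A) \<inter> P)"
    using A by (intro compact_Int_closed compact_Times compact_Icc)
  then have "compact P" by (simp add: P_def Int_assoc[symmetric])
  then have T: "compact (fst ` P)"
    by (intro compact_continuous_image continuous_intros)
  have "(1, x) \<in> P" using x by (simp add: P_def)
  then have "fst ` P \<noteq> {}" by blast
  with compact_attains_inf[OF T] obtain r where r: "r \<in> fst ` P" "\<And>t. t \<in> fst ` P \<Longrightarrow> r \<le> t"
    by blast
  then obtain a where a: "0 \<le> r" "r \<le> 1" "a \<in> A" "x = r *\<^sub>R a"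
    unfolding P_def by auto
  have "Pair x -` free_join A B = (*\<^sub>R) (1 - r) ` B" if B: "convex B" "0 \<in> B" for B :: "'b set"
  proof (intro equalityI subsetI)
    fix y assume "y \<in> Pair x -` free_join A B"
    then obtain t c b where t: "0 \<le> t" "t \<le> 1" "c \<in> A" "b \<in> B" "x = t *\<^sub>R c" "y = (1 - t) *\<^sub>R b"
      by (auto simp: mem_free_join)
    then have "t \<in> fst ` P" unfolding P_def by force
    then have "r \<le> t" using r by blast
    \<comment> \<open>The missing weight \<open>t - r\<close> is put on the origin of
      \<open>B\<close>, which enlarges the scaling factor from \<open>1 - t\<close> to
      \<open>1 - r\<close>.\<close>
    obtain z where "z \<in> B" "(1 - t) *\<^sub>R b + (t - r) *\<^sub>R 0 = ((1 - t) + (t - r)) *\<^sub>R z"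
      using convex_conic_combination[OF B(1) \<open>b \<in> B\<close> B(2), of "1 - t" "t - r"] t \<open>r \<le> t\<close>
      by (metis diff_ge_0_iff_ge)
    with t show "y \<in> (*\<^sub>R) (1 - r) ` B" by auto
  next
    fix y assume "y \<in> (*\<^sub>R) (1 - r) ` B"
    with a show "y \<in> Pair x -` free_join A B" by (auto intro: free_joinI)
  qed
  with a that show ?thesis by blast
qed

lemma free_join_fibre_outside:
  assumes "convex A" "0 \<in> A" "x \<notin> A"
  shows "Pair x -` free_join A B = {}"
proof -
  have "t *\<^sub>R a \<in> A" if "a \<in> A" "0 \<le> t" "t \<le> 1" for t a
    using convexD[OF \<open>convex A\<close> that(1) \<open>0 \<in> A\<close>, of t "1 - t"] that by simp
  then show ?thesis using assms(3) by (auto simp: mem_free_join)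
qed

section \<open>Volume under scaling, translation, slicing and shears\<close>

lemma emeasure_lborel_scaleR:
  fixes B :: "'a::euclidean_space set"
  assumes "compact B"
  shows "emeasure lborel ((*\<^sub>R) c ` B) = ennreal (\<bar>c\<bar> ^ DIM('a)) * emeasure lborel B"
proof -
  have "compact ((*\<^sub>R) c ` B)"
    using assms by (rule compact_scaling)
  then show ?thesis
    using emeasure_lebesgue_affine[of c "0::'a" B] assms
    by (simp add: borel_compact ennreal_power)
qed

lemma emeasure_lborel_translation:
  fixes B :: "'a::euclidean_space set"
  assumes "B \<in> sets borel"
  shows "emeasure lborel ((+) c -` B) = emeasure lborel B"
proof -
  have "emeasure lborel B = emeasure (distr lborel borel ((+) c)) B"
    by (simp only: lborel_distr_plus)
  also have "\<dots> = emeasure lborel ((+) c -` B)"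
    using assms by (subst emeasure_distr) auto
  finally show ?thesis by simp
qed

text \<open>Tonelli's theorem for the indicator of \<open>S\<close>, slicing in either direction.
  The measurability clause allows constants to be moved into the integral.\<close>

lemma emeasure_lborel_fibres:
  fixes S :: "('a::euclidean_space \<times> 'b::euclidean_space) set"
  assumes "S \<in> sets borel"
  shows "emeasure lborel S = (\<integral>\<^sup>+x. emeasure lborel (Pair x -` S) \<partial>lborel)"
    and "emeasure lborel S = (\<integral>\<^sup>+y. emeasure lborel ((\<lambda>x. (x, y)) -` S) \<partial>lborel)"
    and "(\<lambda>x. emeasure lborel (Pair x -` S)) \<in> borel_measurable (lborel :: 'a measure)"
proof -
  have S: "S \<in> sets (lborel \<Otimes>\<^sub>M lborel)"
    using assms by (simp only: lborel_prod sets_lborel)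
  show "emeasure lborel S = (\<integral>\<^sup>+x. emeasure lborel (Pair x -` S) \<partial>lborel)"
    using lborel.emeasure_pair_measure_alt[OF S] by (simp add: lborel_prod)
  show "emeasure lborel S = (\<integral>\<^sup>+y. emeasure lborel ((\<lambda>x. (x, y)) -` S) \<partial>lborel)"
    using lborel_pair.emeasure_pair_measure_alt2[OF S] by (simp add: lborel_prod)
  show "(\<lambda>x. emeasure lborel (Pair x -` S)) \<in> borel_measurable (lborel :: 'a measure)"
    using lborel.measurable_emeasure_Pair[OF S] .
qed

text \<open>A shear translates each fibre, over \<open>x\<close> by a multiple of \<open>x\<close>,
  so slicing shows invariance without a determinant.\<close>

lemma emeasure_lborel_shear_snd:
  fixes S :: "('a::euclidean_space \<times> 'a) set"
  assumes S: "S \<in> sets borel"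
  shows "emeasure lborel ((\<lambda>(x, y). (x, c *\<^sub>R x + y)) -` S) = emeasure lborel S"
proof -
  let ?T = "\<lambda>(x::'a, y::'a). (x, c *\<^sub>R x + y)"
  have "?T \<in> borel_measurable borel"
    unfolding case_prod_unfold by (intro borel_measurable_continuous_onI continuous_intros)
  then have T: "?T -` S \<in> sets borel"
    using S by (rule measurable_sets_borel)
  have "Pair x -` S \<in> sets borel" for x :: 'a
    using sets_Pair1[of S lborel lborel x] S by (simp only: lborel_prod sets_lborel)
  moreover have "Pair x -` ?T -` S = (+) (c *\<^sub>R x) -` Pair x -` S" for x
    by auto
  ultimately show ?thesis
    using emeasure_lborel_fibres(1)[OF S] emeasure_lborel_fibres(1)[OF T]
    by (simp add: emeasure_lborel_translation)
qed

lemma emeasure_lborel_shear_fst: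
  fixes S :: "('a::euclidean_space \<times> 'a) set"
  assumes S: "S \<in> sets borel"
  shows "emeasure lborel ((\<lambda>(x, y). (c *\<^sub>R y + x, y)) -` S) = emeasure lborel S"
proof -
  let ?T = "\<lambda>(x::'a, y::'a). (c *\<^sub>R y + x, y)"
  have "?T \<in> borel_measurable borel"
    unfolding case_prod_unfold by (intro borel_measurable_continuous_onI continuous_intros)
  then have T: "?T -` S \<in> sets borel"
    using S by (rule measurable_sets_borel)
  have "(\<lambda>x. (x, y)) -` S \<in> sets borel" for y :: 'a
    using sets_Pair2[of S lborel lborel y] S by (simp only: lborel_prod sets_lborel)
  moreover have "(\<lambda>x. (x, y)) -` ?T -` S = (+) (c *\<^sub>R y) -` (\<lambda>x. (x, y)) -` S" for y
    by auto
  ultimately show ?thesis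
    using emeasure_lborel_fibres(2)[OF S] emeasure_lborel_fibres(2)[OF T]
    by (simp add: emeasure_lborel_translation)
qed

section \<open>Volumes of free joins\<close>

lemma borel_free_join:
  fixes A :: "'a::euclidean_space set" and B :: "'b::euclidean_space set"
  assumes "compact A" "compact B"
  shows "free_join A B \<in> sets borel"
  using compact_free_join[OF assms] by (rule borel_compact)

lemma emeasure_free_join_commute:
  fixes A :: "'a::euclidean_space set" and B :: "'b::euclidean_space set"
  assumes "compact A" "compact B"
  shows "emeasure lborel (free_join A B) = emeasure lborel (free_join B A)"
proof -
  have "Pair x -` free_join A B = (\<lambda>y. (y, x)) -` free_join B A" for x
    by (auto dest: free_join_swap)
  then show ?thesis
    using emeasure_lborel_fibres(1)[OF borel_free_join[OF assms]]
      emeasure_lborel_fibres(2)[OF borel_free_join[OF assms(2,1)]]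
    by simp
qed

text \<open>The identity holds fibre by fibre: over \<open>x \<in> A\<close> both fibres carry the
  same factor, a power of \<open>1 - r\<close>, and outside \<open>A\<close> both are empty. The
  cross-multiplied form avoids division in \<open>ennreal\<close>.\<close>

lemma emeasure_free_join_exchange:
  fixes A :: "'a::euclidean_space set" and B C :: "'b::euclidean_space set"
  assumes A: "compact A" "convex A" "0 \<in> A"
    and B: "compact B" "convex B" "0 \<in> B"
    and C: "compact C" "convex C" "0 \<in> C"
  shows "emeasure lborel C * emeasure lborel (free_join A B)
    = emeasure lborel B * emeasure lborel (free_join A C)"
proof -
  note mAB = borel_free_join[OF A(1) B(1)] and mAC = borel_free_join[OF A(1) C(1)]
  have "emeasure lborel C * emeasure lborel (Pair x -` free_join A B)
    = emeasure lborel B * emeasure lborel (Pair x -` free_join A C)" for x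
  proof (cases "x \<in> A")
    case True
    then obtain r where "Pair x -` free_join A B = (*\<^sub>R) (1 - r) ` B"
        "Pair x -` free_join A C = (*\<^sub>R) (1 - r) ` C"
      using free_join_fibre[OF A(1), where 'b='b] B C by metis
    with B C show ?thesis by (simp add: emeasure_lborel_scaleR mult_ac)
  next
    case False
    then show ?thesis using A by (simp add: free_join_fibre_outside)
  qed
  then show ?thesis
    unfolding emeasure_lborel_fibres(1)[OF mAB] emeasure_lborel_fibres(1)[OF mAC]
      nn_integral_cmult[OF emeasure_lborel_fibres(3)[OF mAB], symmetric]
      nn_integral_cmult[OF emeasure_lborel_fibres(3)[OF mAC], symmetric]
    by simp
qed

lemma emeasure_free_join_le:
  fixes K :: "'a::euclidean_space set" and l :: real
  defines "D \<equiv> convex hull (((\<lambda>x. (1 - l) *\<^sub>R x) ` K) \<union> ((\<lambda>x. (- l) *\<^sub>R x) ` K))"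
  assumes K: "compact K" "convex K" "0 \<in> K" and l: "0 \<le> l" "l \<le> 1"
    and D: "compact D" "0 \<in> D"
  shows "emeasure lborel (free_join D K) \<le> emeasure lborel (free_join K K)"
proof -
  note mKK = borel_free_join[OF K(1) K(1)]
  \<comment> \<open>\<open>W\<close> is the image of \<open>free_join K K\<close> under the map
    \<open>(u, v) \<mapsto> ((1 - l) u - l v, u + v)\<close>. It is written as a preimage under the
    inverse map, which factors into two shears.\<close>
  define W where "W = (\<lambda>(x, y). (l *\<^sub>R y + x, y)) -` (\<lambda>(x, y). (x, (-1) *\<^sub>R x + y)) -` free_join K K"
  have mem_W: "(x, y) \<in> W \<longleftrightarrow> (x + l *\<^sub>R y, (1 - l) *\<^sub>R y - x) \<in> free_join K K" for x y
    unfolding W_def by (simp add: algebra_simps)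
  have "(\<lambda>(x::'a, y::'a). (x, (-1) *\<^sub>R x + y)) \<in> borel_measurable borel"
    unfolding case_prod_unfold by (intro borel_measurable_continuous_onI continuous_intros)
  then have 1: "(\<lambda>(x, y). (x, (-1) *\<^sub>R x + y)) -` free_join K K \<in> sets borel"
    using mKK by (rule measurable_sets_borel)
  have "(\<lambda>(x::'a, y::'a). (l *\<^sub>R y + x, y)) \<in> borel_measurable borel"
    unfolding case_prod_unfold by (intro borel_measurable_continuous_onI continuous_intros)
  then have W: "W \<in> sets borel"
    unfolding W_def using 1 by (rule measurable_sets_borel)
  have "emeasure lborel W = emeasure lborel (free_join K K)"
    by (simp only: W_def emeasure_lborel_shear_fst[OF 1] emeasure_lborel_shear_snd[OF mKK])
  moreover have "emeasure lborel (Pair x -` free_join D K) \<le> emeasure lborel (Pair x -` W)" for x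
  proof (cases "x \<in> D")
    case True
    then obtain r where r: "0 \<le> r" "r \<le> 1" "x \<in> (*\<^sub>R) r ` D"
      "Pair x -` free_join D K = (*\<^sub>R) (1 - r) ` K"
      using free_join_fibre[OF D(1), where 'b='a] K by metis
    then obtain d where d: "d \<in> D" "x = r *\<^sub>R d" by auto
    have "D = {u *\<^sub>R s + v *\<^sub>R t | u v s t. u \<ge> 0 \<and> v \<ge> 0 \<and> u + v = 1 \<and>
        s \<in> (\<lambda>x. (1 - l) *\<^sub>R x) ` K \<and> t \<in> (\<lambda>x. (- l) *\<^sub>R x) ` K}"
      unfolding D_def using K by (intro convex_hull_union_two convex_scaling) auto
    then obtain u v a b where uv: "u \<ge> 0" "v \<ge> 0" "u + v = 1" "a \<in> K" "b \<in> K"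
      and d_eq: "d = u *\<^sub>R ((1 - l) *\<^sub>R a) + v *\<^sub>R ((- l) *\<^sub>R b)"
      using d(1) by auto
    \<comment> \<open>The map sends this point to \<open>(d, u *\<^sub>R a + v *\<^sub>R b)\<close>,
      a point of \<open>W\<close> over \<open>d\<close>.\<close>
    then have p: "(u *\<^sub>R a, v *\<^sub>R b) \<in> free_join K K"
      by (intro free_joinI[of u a K b K]) auto
    \<comment> \<open>The translation vector: \<open>r\<close> times the point over \<open>d\<close>
      plus \<open>1 - r\<close> times a point \<open>(0, k)\<close> of \<open>W\<close> lies over
      \<open>x = r *\<^sub>R d\<close>, with second coordinate
      \<open>?c + (1 - r) *\<^sub>R k\<close>.\<close>
    let ?c = "r *\<^sub>R (u *\<^sub>R a + v *\<^sub>R b)"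
    have sub: "(*\<^sub>R) (1 - r) ` K \<subseteq> (+) ?c -` (Pair x -` W)"
    proof clarsimp
      fix k assume k: "k \<in> K"
      \<comment> \<open>The map sends this point to \<open>(0, k)\<close>, so the fibre of
        \<open>W\<close> over the origin contains \<open>K\<close>.\<close>
      then have q: "(l *\<^sub>R k, (1 - l) *\<^sub>R k) \<in> free_join K K"
        using l by (intro free_joinI[of l k K k K]) auto
      have "x + l *\<^sub>R (?c + (1 - r) *\<^sub>R k) = r *\<^sub>R u *\<^sub>R a + (1 - r) *\<^sub>R l *\<^sub>R k"
        unfolding d(2) d_eq by (simp add: algebra_simps)
      moreover have "(1 - l) *\<^sub>R (?c + (1 - r) *\<^sub>R k) - x = r *\<^sub>R v *\<^sub>R b + (1 - r) *\<^sub>R (1 - l) *\<^sub>R k"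
        unfolding d(2) d_eq by (simp add: algebra_simps)
      ultimately show "(x, ?c + (1 - r) *\<^sub>R k) \<in> W"
        unfolding mem_W using convex_free_join_combination[OF K(2) K(2) p q r(1,2)] by simp
    qed
    have Wx: "Pair x -` W \<in> sets borel"
      using sets_Pair1[of W lborel lborel x] W by (simp only: lborel_prod sets_lborel)
    have "(+) ?c -` (Pair x -` W) \<in> sets borel"
      using Wx by (intro measurable_sets_borel[where M=borel and A="Pair x -` W"]) simp_all
    then have "emeasure lborel ((*\<^sub>R) (1 - r) ` K) \<le> emeasure lborel ((+) ?c -` (Pair x -` W))"
      using sub by (intro emeasure_mono) auto
    then show ?thesis
      unfolding r(4) emeasure_lborel_translation[OF Wx] .
  next
    case False
    then show ?thesis using D by (simp add: free_join_fibre_outside D_def)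
  qed
  ultimately show ?thesis
    using emeasure_lborel_fibres(1)[OF W] emeasure_lborel_fibres(1)[OF borel_free_join[OF D(1) K(1)]]
    by (metis nn_integral_mono)
qed

text \<open>The parameter value 1/2 already yields a half-size copy of \<open>A \<times> B\<close>.
  Positivity lets the volume of \<open>free_join K K\<close> be cancelled at the end.\<close>

lemma emeasure_free_join_pos:
  fixes A :: "'a::euclidean_space set" and B :: "'b::euclidean_space set"
  assumes "interior A \<noteq> {}" "interior B \<noteq> {}" "compact A" "compact B"
  shows "0 < emeasure lborel (free_join A B)"
proof -
  have pos: "0 < emeasure lborel S" if "interior S \<noteq> {}" "compact S" for S :: "'c::euclidean_space set"
  proof -
    obtain x e where "0 < e" "ball x e \<subseteq> S"
      using \<open>interior S \<noteq> {}\<close> mem_interior by blast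
    then have "emeasure lborel (ball x e) \<le> emeasure lborel S"
      using \<open>compact S\<close> by (intro emeasure_mono) (auto simp: borel_compact)
    moreover have "0 < emeasure lborel (ball x e)"
      using \<open>0 < e\<close> by (simp add: emeasure_ball unit_ball_vol_pos ennreal_zero_less_mult_iff)
    ultimately show ?thesis by order
  qed
  have sub: "(*\<^sub>R) (1/2) ` (A \<times> B) \<subseteq> free_join A B"
    by (auto intro!: free_joinI[of "1/2"])
  have AB: "compact (A \<times> B)" using assms by (simp add: compact_Times)
  have "0 < emeasure lborel (A \<times> B)"
    using assms AB by (intro pos) (auto simp: interior_Times)
  then have "0 < emeasure lborel ((*\<^sub>R) (1/2) ` (A \<times> B))"
    unfolding emeasure_lborel_scaleR[OF AB] by (simp add: ennreal_zero_less_mult_iff)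
  also have "\<dots> \<le> emeasure lborel (free_join A B)"
    using sub borel_free_join assms by (intro emeasure_mono) auto
  finally show ?thesis .
qed

theorem theorem1p5:
  fixes K :: "'a::euclidean_space set" and l :: real
  assumes "convex_body K" and "0 \<in> K" and "0 \<le> l" and "l \<le> 1"
  shows "measure lebesgue
           (convex hull (((\<lambda>x. (1 - l) *\<^sub>R x) ` K) \<union> ((\<lambda>x. (- l) *\<^sub>R x) ` K)))
         \<le> measure lebesgue K"
proof -
  define D where "D = convex hull (((\<lambda>x. (1 - l) *\<^sub>R x) ` K) \<union> ((\<lambda>x. (- l) *\<^sub>R x) ` K))"
  have K: "compact K" "convex K" "interior K \<noteq> {}"
    using assms(1) by (auto simp: convex_body_def)
  have D: "compact D" "convex D"
    unfolding D_def using K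
    by (intro compact_convex_hull compact_Un compact_scaling convex_convex_hull; simp)+
  have "0 \<in> D"
    unfolding D_def using \<open>0 \<in> K\<close> by (intro hull_inc) force
  let ?j = "emeasure lborel (free_join K K)"
  have "emeasure lborel D * ?j = emeasure lborel K * emeasure lborel (free_join K D)"
    using K D \<open>0 \<in> K\<close> \<open>0 \<in> D\<close> by (intro emeasure_free_join_exchange)
  also have "\<dots> = emeasure lborel K * emeasure lborel (free_join D K)"
    using emeasure_free_join_commute[OF K(1) D(1)] by simp
  also have "\<dots> \<le> emeasure lborel K * ?j"
    using emeasure_free_join_le[of K l] K D assms \<open>0 \<in> D\<close>
    unfolding D_def by (intro mult_left_mono) auto
  finally have "?j * emeasure lborel D \<le> ?j * emeasure lborel K"
    by (simp add: mult.commute)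
  \<comment> \<open>Cancelling \<open>?j\<close> in \<open>ennreal\<close> requires it to be
    nonzero, by the interior of \<open>K\<close>, and finite, by compactness.\<close>
  moreover have "?j \<noteq> 0" "?j < top"
    using emeasure_free_join_pos[OF K(3) K(3) K(1) K(1)]
      emeasure_compact_finite[OF compact_free_join[OF K(1) K(1)]] by auto
  ultimately have "emeasure lborel D \<le> emeasure lborel K"
    by (simp add: ennreal_mult_le_mult_iff)
  then have "measure lborel D \<le> measure lborel K"
    using emeasure_compact_finite[OF K(1)] unfolding measure_def
    by (intro enn2real_mono) auto
  \<comment> \<open>Both sets are compact, hence Borel, where \<open>lborel\<close> and
    \<open>lebesgue\<close> agree.\<close>
  then show ?thesis
    using K D by (simp add: D_def borel_compact)
qed

end
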